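(* There is an absolute constant $c>0$ such that for all sufficiently large $n$, every deterministic truthful mechanism for the matching market with $n$ agents and $n$ items has rank-approximation factor at least $c\cdot\frac{\log\log n}{\log\log\log n}$.
   Context: Matching market: $n$ agents and $m$ items (here $m=n$); each agent $j$ reports any strict total order $\succ_j$ on the items. An outcome is a matching; an unmatched agent receives the null item, ranked below every item. A deterministic mechanism maps each profile to a matching; it is truthful if for every agent $j$, $\succ_{-j}$, and $\succ_j,\succ'_j$, the item $j$ receives under $(\succ_j,\succ_{-j})$ is weakly preferred under $\succ_j$ to the item $j$ receives under $(\succ'_j,\succ_{-j})$. $\mathrm{rank}_i(M;\succ)$ is the number of agents assigned one of their top-$i$ items by $M$, $\mathrm{maxrank}_i(\succ)$ its maximum over matchings; a mechanism has rank-approximation factor $\alpha$ if on every profile its output satisfies $\mathrm{rank}_i\ge\mathrm{maxrank}_i/\alpha$ for all $i$. *)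

theory Defs
  imports Complex_Main
begin

text \<open>Agents and items are both 0..<n. A preference of an agent is encoded by its
  rank function r: r x is the position of item x in the agent's strict order
  (0 = most preferred); r is a bijection of {0..<n}, and canonically r x = n off the items.\<close>

definition valid_pref :: "nat \<Rightarrow> (nat \<Rightarrow> nat) \<Rightarrow> bool" where
  "valid_pref n r \<longleftrightarrow> bij_betw r {0..<n} {0..<n} \<and> (\<forall>x\<ge>n. r x = n)"

definition valid_profile :: "nat \<Rightarrow> (nat \<Rightarrow> nat \<Rightarrow> nat) \<Rightarrow> bool" where
  "valid_profile n P \<longleftrightarrow> (\<forall>j<n. valid_pref n (P j)) \<and> (\<forall>j\<ge>n. P j = (\<lambda>_. n))"

definition is_matching :: "nat \<Rightarrow> (nat \<Rightarrow> nat option) \<Rightarrow> bool" where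
  "is_matching n m \<longleftrightarrow>
     (\<forall>j x. m j = Some x \<longrightarrow> j < n \<and> x < n) \<and> inj_on m {j. m j \<noteq> None}"

text \<open>Position of an outcome under rank function r (of an n-item market);
  the null item is ranked below every item.\<close>
definition outcome_rank :: "nat \<Rightarrow> (nat \<Rightarrow> nat) \<Rightarrow> nat option \<Rightarrow> nat" where
  "outcome_rank n r a = (case a of None \<Rightarrow> n | Some x \<Rightarrow> r x)"

type_synonym mechanism = "(nat \<Rightarrow> nat \<Rightarrow> nat) \<Rightarrow> nat \<Rightarrow> nat option"

definition is_mechanism :: "nat \<Rightarrow> mechanism \<Rightarrow> bool" where
  "is_mechanism n M \<longleftrightarrow> (\<forall>P. valid_profile n P \<longrightarrow> is_matching n (M P))"

definition truthful :: "nat \<Rightarrow> mechanism \<Rightarrow> bool" where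
  "truthful n M \<longleftrightarrow>
     (\<forall>P j r'. valid_profile n P \<longrightarrow> j < n \<longrightarrow> valid_pref n r' \<longrightarrow>
        outcome_rank n (P j) (M P j) \<le> outcome_rank n (P j) (M (P(j := r')) j))"

definition rank_count :: "nat \<Rightarrow> (nat \<Rightarrow> nat \<Rightarrow> nat) \<Rightarrow> nat \<Rightarrow> (nat \<Rightarrow> nat option) \<Rightarrow> nat" where
  "rank_count n P i m = card {j. j < n \<and> (\<exists>x. m j = Some x \<and> P j x < i)}"

definition maxrank :: "nat \<Rightarrow> (nat \<Rightarrow> nat \<Rightarrow> nat) \<Rightarrow> nat \<Rightarrow> nat" where
  "maxrank n P i = Max {rank_count n P i m | m. is_matching n m}"

definition rank_approx :: "nat \<Rightarrow> mechanism \<Rightarrow> real \<Rightarrow> bool" where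
  "rank_approx n M \<alpha> \<longleftrightarrow> \<alpha> > 0 \<and>
     (\<forall>P i. valid_profile n P \<longrightarrow>
        real (rank_count n P i (M P)) \<ge> real (maxrank n P i) / \<alpha>)"

end

theory Submission
  imports Defs "HOL-Library.FuncSet" "HOL-Real_Asymp.Real_Asymp"
begin

text \<open>Already the bound on \<open>rank\<^sub>1\<close> forces a factor polynomial in \<open>n\<close>. Let all agents share the
  order \<open>0, 1, 2, \<dots>\<close>, except for agents \<open>j\<^sub>0, \<dots>, j\<^sub>k\<^sub>-\<^sub>1\<close>, where \<open>j\<^sub>b\<close> moves item \<open>b\<close> to
  the front. Then \<open>maxrank\<^sub>1 \<ge> k\<close>. If \<open>j\<^sub>b\<close> receives \<open>b\<close>, then by truthfulness she would receive one
  of the items below \<open>k\<close> after switching to the common order; but for fixed reports of the others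
  only \<open>k\<close> agents receive such an item. So for random \<open>j\<^sub>b\<close>, a union bound over \<open>b\<close> yields a
  choice for which no \<open>j\<^sub>b\<close> is satisfied, and \<open>rank\<^sub>1 \<le> 1\<close>.\<close>

section \<open>Union bound over a product of finite sets\<close>

text \<open>Overwriting coordinate \<open>i\<close> by the fixed value \<open>u\<close> makes
  \<open>B (f(i := u))\<close> independent of \<open>f i\<close>. Once the other coordinates are
  chosen, at most \<open>m\<close> values of \<open>f i\<close> are hits.\<close>

lemma card_PiE_hits_le:
  assumes "finite I" "i \<in> I"
    and A: "\<And>i. i \<in> I \<Longrightarrow> finite (A i)" "\<And>i. i \<in> I \<Longrightarrow> card (A i) = s"
    and B: "\<And>g. finite (B g)" "\<And>g. card (B g) \<le> m"
  shows "card {f \<in> PiE I A. f i \<in> B (f(i := u))} \<le> s ^ (card I - 1) * m"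
proof -
  let ?G = "PiE (I - {i}) A"
  let ?U = "\<Union>g\<in>?G. (\<lambda>x. g(i := x)) ` B (g(i := u))"
  have finG: "finite ?G"
    using assms by (intro finite_PiE) auto
  have sub: "{f \<in> PiE I A. f i \<in> B (f(i := u))} \<subseteq> ?U"
  proof
    fix f assume f: "f \<in> {f \<in> PiE I A. f i \<in> B (f(i := u))}"
    let ?g = "f(i := undefined)"
    have "?g \<in> ?G"
      using f by (auto simp: PiE_iff extensional_def)
    moreover have "f = ?g(i := f i)" "?g(i := u) = f(i := u)"
      by auto
    ultimately show "f \<in> ?U"
      using f by (metis (no_types, lifting) UN_I image_eqI mem_Collect_eq)
  qed
  have "card {f \<in> PiE I A. f i \<in> B (f(i := u))} \<le> card ?U"
    by (intro card_mono sub) (use finG B in auto)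
  also have "\<dots> \<le> (\<Sum>g\<in>?G. card ((\<lambda>x. g(i := x)) ` B (g(i := u))))"
    by (rule card_UN_le[OF finG])
  also have "\<dots> \<le> (\<Sum>g\<in>?G. m)"
    by (intro sum_mono order_trans[OF card_image_le]) (use B in auto)
  also have "\<dots> = s ^ (card I - 1) * m"
    using assms by (simp add: card_PiE)
  finally show ?thesis .
qed

text \<open>For each \<open>i\<close> the hits are at most a fraction \<open>m / s\<close> of all
  choices, so \<open>card I * m < s\<close> leaves a choice that avoids all of them.\<close>

lemma exists_free_choice:
  assumes "finite I"
    and A: "\<And>i. i \<in> I \<Longrightarrow> finite (A i)" "\<And>i. i \<in> I \<Longrightarrow> card (A i) = s"
    and B: "\<And>g. finite (B g)" "\<And>g. card (B g) \<le> m"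
    and s: "card I * m < s"
  shows "\<exists>f \<in> PiE I A. \<forall>i\<in>I. f i \<notin> B (f(i := u))"
proof (rule ccontr)
  let ?bad = "\<lambda>i. {f \<in> PiE I A. f i \<in> B (f(i := u))}"
  assume "\<not> ?thesis"
  then have sub: "PiE I A \<subseteq> (\<Union>i\<in>I. ?bad i)"
    by blast
  have fin: "finite (PiE I A)"
    using assms by (intro finite_PiE) auto
  have "I \<noteq> {}"
    using sub by auto
  then have I: "card I > 0"
    using \<open>finite I\<close> by (simp add: card_gt_0_iff)
  have "s ^ card I = card (PiE I A)"
    using assms by (simp add: card_PiE)
  also have "\<dots> \<le> card (\<Union>i\<in>I. ?bad i)"
    by (intro card_mono sub) (use fin \<open>finite I\<close> in auto)
  also have "\<dots> \<le> (\<Sum>i\<in>I. card (?bad i))"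
    by (rule card_UN_le[OF \<open>finite I\<close>])
  also have "\<dots> \<le> (\<Sum>i\<in>I. s ^ (card I - 1) * m)"
    by (intro sum_mono card_PiE_hits_le assms)
  also have "\<dots> = s ^ (card I - 1) * (card I * m)"
    by simp
  also have "\<dots> < s ^ (card I - 1) * s"
    using s by (intro mult_strict_left_mono) auto
  also have "\<dots> = s ^ card I"
    using I by (metis Suc_diff_1 power_Suc2)
  finally show False by simp
qed

section \<open>The two orders, rank counts and low items\<close>

definition common_pref :: "nat \<Rightarrow> nat \<Rightarrow> nat" where
  "common_pref n x = (if x < n then x else n)"

definition front_pref :: "nat \<Rightarrow> nat \<Rightarrow> nat \<Rightarrow> nat" where
  "front_pref n b x = (if x = b then 0 else if x < b then Suc x else if x < n then x else n)"

lemma valid_common_pref: "valid_pref n (common_pref n)"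
  unfolding valid_pref_def common_pref_def
  by (auto simp: bij_betw_def inj_on_def image_def)

lemma valid_front_pref:
  assumes "b < n"
  shows "valid_pref n (front_pref n b)"
proof -
  have inj: "inj_on (front_pref n b) {0..<n}"
    using assms by (auto simp: inj_on_def front_pref_def split: if_splits)
  have "front_pref n b ` {0..<n} \<subseteq> {0..<n}"
    using assms by (auto simp: front_pref_def)
  then have "front_pref n b ` {0..<n} = {0..<n}"
    using inj by (intro endo_inj_surj) auto
  then show ?thesis
    using inj assms by (auto simp: valid_pref_def bij_betw_def front_pref_def)
qed

lemma rank_count_le_n: "rank_count n P i m \<le> n"
proof -
  have "rank_count n P i m \<le> card {..<n}"
    unfolding rank_count_def by (intro card_mono) auto
  then show ?thesis by simp
qed

lemma rank_count_le_maxrank: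
  assumes "is_matching n m"
  shows "rank_count n P i m \<le> maxrank n P i"
  unfolding maxrank_def
proof (rule Max_ge)
  show "finite {rank_count n P i m |m. is_matching n m}"
    by (rule finite_subset[of _ "{..n}"]) (auto simp: rank_count_le_n)
qed (use assms in auto)

lemma card_agents_low_items_le:
  assumes "is_matching n m"
  shows "card {j. j < n \<and> (\<exists>x<k. m j = Some x)} \<le> k"
proof -
  let ?S = "{j. j < n \<and> (\<exists>x<k. m j = Some x)}"
  have "card ?S = card (m ` ?S)"
    using assms by (intro card_image[symmetric])
      (auto simp: is_matching_def inj_on_def)
  also have "\<dots> \<le> card (Some ` {..<k})"
    by (intro card_mono) auto
  also have "\<dots> = k"
    by (simp add: card_image)
  finally show ?thesis .
qed

section \<open>The hard profile\<close>

text \<open>The hypothesis on \<open>n\<close> makes room for \<open>k\<close> disjoint blocks of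
  \<open>k * k + 1\<close> agents, one block of candidates for each deviating agent.\<close>

lemma rank_approx_ge:
  assumes mech: "is_mechanism n M" and truth: "truthful n M" and approx: "rank_approx n M \<alpha>"
    and n: "k * (k * k + 1) \<le> n"
  shows "\<alpha> \<ge> real k"
proof (cases "k = 0")
  case True
  then show ?thesis using approx by (simp add: rank_approx_def)
next
  case False
  \<comment> \<open>The union bound has \<open>k\<close> events, each with at most \<open>k\<close>
    bad values, so a block must have more than \<open>k * k\<close> agents.\<close>
  define s where "s = k * k + 1"
  have s: "s > 0" "k * k < s" "k * s \<le> n"
    using n by (auto simp: s_def)
  have "k * 1 \<le> k * s"
    using s by (intro mult_le_mono2) auto
  then have kn: "k \<le> n"
    using s(3) by linarith
  \<comment> \<open>Block \<open>b\<close> consists of the agents \<open>j\<close> with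
    \<open>j div s = b\<close>; in it only \<open>f b\<close> can be special.\<close>
  define special where "special f j \<longleftrightarrow> j div s < k \<and> f (j div s) = j"
    for f :: "nat \<Rightarrow> nat" and j
  define P where "P f j = (if j \<ge> n then (\<lambda>_. n)
      else if special f j then front_pref n (j div s) else common_pref n)" for f j
  have validP: "valid_profile n (P f)" for f
    using valid_common_pref valid_front_pref kn
    by (auto simp: valid_profile_def P_def special_def)
  have matching: "is_matching n (M (P f))" for f
    using mech validP by (auto simp: is_mechanism_def)
  define B where "B f = {j. j < n \<and> (\<exists>x<k. M (P f) j = Some x)}" for f
  \<comment> \<open>The value \<open>n\<close> is not an agent, so under \<open>f(b := n)\<close>
    all of block \<open>b\<close> reports the common order.\<close>
  have "\<exists>f \<in> PiE {..<k} (\<lambda>b. {b*s..<b*s+s}). \<forall>b\<in>{..<k}. f b \<notin> B (f(b := n))"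
  proof (rule exists_free_choice)
    show "card (B g) \<le> k" for g
      unfolding B_def by (rule card_agents_low_items_le[OF matching])
    show "finite (B g)" for g
      by (simp add: B_def)
  qed (use s in auto)
  then obtain f where f: "f \<in> PiE {..<k} (\<lambda>b. {b*s..<b*s+s})"
    and free: "\<And>b. b < k \<Longrightarrow> f b \<notin> B (f(b := n))"
    by auto
  have fb: "b * s \<le> f b" "f b < b * s + s" if "b < k" for b
    using f that by (auto simp: PiE_iff)
  have div: "f b div s = b" if "b < k" for b
    using fb[OF that] by (intro div_nat_eqI) (auto simp: algebra_simps)
  have fn: "f b < n" if "b < k" for b
  proof -
    have "Suc b * s \<le> k * s"
      using that by (intro mult_le_mono1) auto
    then show ?thesis using fb[OF that] s by simp
  qed
  have special_f: "special f (f b)" if "b < k" for b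
    using that div by (simp add: special_def)
  have unsatisfied: "M (P f) (f b) \<noteq> Some b" if b: "b < k" for b
  proof
    assume got: "M (P f) (f b) = Some b"
    let ?Q = "P (f(b := n))"
    have Q: "?Q (f b) = common_pref n"
      using fn[OF b] div[OF b] by (simp add: P_def special_def)
    have dev: "?Q(f b := front_pref n b) = P f"
    proof
      fix j
      show "(?Q(f b := front_pref n b)) j = P f j"
        using fn[OF b] div[OF b] b by (auto simp: P_def special_def)
    qed
    \<comment> \<open>Truthfulness is applied at \<open>?Q\<close>, where \<open>f b\<close> holds
      the common order: reporting \<open>front_pref n b\<close> would yield item \<open>b\<close>,
      at position \<open>b\<close>, so the truthful report yields an item no worse than that, hence
      below \<open>k\<close>.\<close>
    have "outcome_rank n (?Q (f b)) (M ?Q (f b))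
        \<le> outcome_rank n (?Q (f b)) (M (?Q(f b := front_pref n b)) (f b))"
      using truth validP fn[OF b] valid_front_pref[of b n] b kn
      unfolding truthful_def by simp
    also have "\<dots> = b"
      using dev got Q b kn by (simp add: outcome_rank_def common_pref_def)
    finally have le: "outcome_rank n (common_pref n) (M ?Q (f b)) \<le> b"
      using Q by simp
    then obtain x where x: "M ?Q (f b) = Some x"
      using b kn by (cases "M ?Q (f b)") (auto simp: outcome_rank_def)
    then have "x < k"
      using le b kn by (auto simp: outcome_rank_def common_pref_def split: if_splits)
    then have "f b \<in> B (f(b := n))"
      using x fn[OF b] by (auto simp: B_def)
    then show False
      using free[OF b] by simp
  qed
  have "{j. j < n \<and> (\<exists>x. M (P f) j = Some x \<and> P f j x < 1)}
      \<subseteq> {j. j < n \<and> (\<exists>x<1. M (P f) j = Some x)}"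
  proof
    fix j assume "j \<in> {j. j < n \<and> (\<exists>x. M (P f) j = Some x \<and> P f j x < 1)}"
    then obtain x where j: "j < n" and x: "M (P f) j = Some x" and top: "P f j x < 1"
      by auto
    \<comment> \<open>The top item of a special agent is that of its block, which it does not
      receive. Every other agent has top item 0, so only the recipient of item 0 can count.\<close>
    have "\<not> special f j"
    proof
      assume sp: "special f j"
      then have b: "j div s < k" "f (j div s) = j"
        by (auto simp: special_def)
      have "x = j div s"
        using top sp j by (auto simp: P_def front_pref_def split: if_splits)
      then show False
        using unsatisfied[OF b(1)] b(2) x by simp
    qed
    then have "x = 0"
      using top j by (auto simp: P_def common_pref_def split: if_splits)
    then show "j \<in> {j. j < n \<and> (\<exists>x<1. M (P f) j = Some x)}"
      using x j by auto
  qed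
  then have "rank_count n (P f) 1 (M (P f)) \<le> card {j. j < n \<and> (\<exists>x<1. M (P f) j = Some x)}"
    unfolding rank_count_def by (intro card_mono) auto
  also have "\<dots> \<le> 1"
    by (rule card_agents_low_items_le[OF matching])
  finally have low: "rank_count n (P f) 1 (M (P f)) \<le> 1" .

  \<comment> \<open>This matching gives all \<open>k\<close> special agents their top items.\<close>
  define m where "m j = (if special f j then Some (j div s) else None)" for j
  have "is_matching n m"
    unfolding is_matching_def
  proof (intro conjI allI impI)
    fix j x assume "m j = Some x"
    then have "x < k" "j = f x"
      by (auto simp: m_def special_def split: if_splits)
    then show "j < n" "x < n"
      using fn kn by auto
  next
    show "inj_on m {j. m j \<noteq> None}"
      by (rule inj_onI) (auto simp: m_def special_def split: if_splits)
  qed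
  then have "rank_count n (P f) 1 m \<le> maxrank n (P f) 1"
    by (rule rank_count_le_maxrank)
  moreover have "k \<le> rank_count n (P f) 1 m"
  proof -
    have "inj_on f {..<k}"
      using div by (intro inj_onI) (metis lessThan_iff)
    then have "k = card (f ` {..<k})"
      by (simp add: card_image)
    also have "\<dots> \<le> rank_count n (P f) 1 m"
      unfolding rank_count_def using special_f fn div
      by (intro card_mono) (auto simp: m_def P_def front_pref_def not_le)
    finally show ?thesis .
  qed
  ultimately have high: "k \<le> maxrank n (P f) 1"
    by linarith
  have \<alpha>: "\<alpha> > 0" "real (maxrank n (P f) 1) / \<alpha> \<le> real (rank_count n (P f) 1 (M (P f)))"
    using approx validP by (auto simp: rank_approx_def)
  have "real k / \<alpha> \<le> real (maxrank n (P f) 1) / \<alpha>"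
    using high \<alpha>(1) by (intro divide_right_mono) auto
  also have "\<dots> \<le> 1"
    using \<alpha>(2) low by linarith
  finally show ?thesis
    using \<alpha>(1) by (simp add: field_simps)
qed

theorem theorem9:
  shows "\<exists>c::real. c > 0 \<and> (\<exists>N::nat. \<forall>n\<ge>N. \<forall>M \<alpha>.
           is_mechanism n M \<longrightarrow> truthful n M \<longrightarrow> rank_approx n M \<alpha> \<longrightarrow>
           \<alpha> \<ge> c * ln (ln (real n)) / ln (ln (ln (real n))))"
proof -
  let ?L = "\<lambda>n::nat. ln (ln (real n))"
  have "\<forall>\<^sub>F n in sequentially. ?L n \<ge> 0"
    "\<forall>\<^sub>F n in sequentially. ln (?L n) \<ge> 1"
    "\<forall>\<^sub>F n in sequentially. (?L n + 1) * ((?L n + 1) * (?L n + 1) + 1) \<le> real n"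
    by real_asymp+
  then have "\<forall>\<^sub>F n in sequentially. ?L n \<ge> 0 \<and> ln (?L n) \<ge> 1 \<and>
      (?L n + 1) * ((?L n + 1) * (?L n + 1) + 1) \<le> real n"
    by eventually_elim simp
  then obtain N where N: "\<And>n. n \<ge> N \<Longrightarrow> ?L n \<ge> 0" "\<And>n. n \<ge> N \<Longrightarrow> ln (?L n) \<ge> 1"
    "\<And>n. n \<ge> N \<Longrightarrow> (?L n + 1) * ((?L n + 1) * (?L n + 1) + 1) \<le> real n"
    by (auto simp: eventually_sequentially)
  have "1 * ?L n / ln (?L n) \<le> \<alpha>"
    if "n \<ge> N" and M: "is_mechanism n M" "truthful n M" "rank_approx n M \<alpha>" for n M \<alpha>
  proof -
    \<comment> \<open>A cube-root-sized \<open>k\<close> would still fit; rounding up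
      \<open>?L n\<close> is enough for the claimed bound.\<close>
    define k where "k = nat \<lceil>?L n\<rceil>"
    have k: "?L n \<le> real k" "real k \<le> ?L n + 1"
      using N(1)[OF \<open>n \<ge> N\<close>] by (simp_all add: k_def)
    have "real (k * (k * k + 1)) = real k * (real k * real k + 1)"
      by (simp add: algebra_simps)
    also have "\<dots> \<le> (?L n + 1) * ((?L n + 1) * (?L n + 1) + 1)"
      using k N(1)[OF \<open>n \<ge> N\<close>] by (intro mult_mono add_mono) auto
    also have "\<dots> \<le> real n"
      by (rule N(3)[OF \<open>n \<ge> N\<close>])
    finally have "k * (k * k + 1) \<le> n"
      by linarith
    from rank_approx_ge[OF M this] have "?L n \<le> \<alpha>"
      using k by linarith
    \<comment> \<open>As \<open>ln (?L n) \<ge> 1\<close>, dividing by it only weakens the bound,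
      and the constant 1 serves as \<open>c\<close>.\<close>
    moreover have "?L n / ln (?L n) \<le> ?L n / 1"
      using N(1,2)[OF \<open>n \<ge> N\<close>] by (intro divide_left_mono) auto
    ultimately show ?thesis
      by simp
  qed
  then show ?thesis
    by (intro exI[of _ 1] conjI exI[of _ N]) auto
qed

end
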